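(* Let $A,B,C\in\mathbb{R}^{n\times n}$ with $C\neq 0$, and suppose the linear operator $S:\mathbb{R}^{n\times n}\to\mathbb{R}^{n\times n}$, $S(Z)=Z-AZ^\top B$, is invertible. Let $X$ be the solution of $X=AX^\top B+C$, and let $\delta A,\delta B,\delta C,\delta X\in\mathbb{R}^{n\times n}$ satisfy the perturbed equation $$X+\delta X=(A+\delta A)(X+\delta X)^\top(B+\delta B)+(C+\delta C).$$ Put $\|\delta S\|_F:=\|A\|_F\|\delta B\|_F+\|\delta A\|_F(\|B\|_F+\|\delta B\|_F)$ and $\kappa(S):=\|S\|_F\,\|S^{-1}\|_F$. If $\|S^{-1}\|_F\,\|\delta S\|_F<1$, then $$\frac{\|\delta X\|_F}{\|X\|_F}\le\frac{\kappa(S)}{1-\kappa(S)\,\|\delta S\|_F/\|S\|_F}\left(\frac{\|\delta C\|_F}{\|C\|_F}+\frac{\|\delta S\|_F}{\|S\|_F}\right).$$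
   Context: For matrices, $\|\cdot\|_F$ is the Frobenius norm. For the linear operators $S$ and $S^{-1}$ on $\mathbb{R}^{n\times n}$, $\|S\|_F$ and $\|S^{-1}\|_F$ denote the operator norms induced by the Frobenius norm. The symbol $\|\delta S\|_F$ is just notation for the number defined in the claim. *)

theory Defs
  imports "HOL-Analysis.Analysis"
begin

text \<open>The library norm on the type of real matrices is the Frobenius norm, so \<^const>\<open>onorm\<close> of a
  linear operator on matrices is the operator norm induced by the Frobenius norm.\<close>

lemma norm_matrix_eq_frobenius:
  fixes M :: "real ^ 'n ^ 'm"
  shows "norm M = sqrt (\<Sum>i\<in>UNIV. \<Sum>j\<in>UNIV. (M $ i $ j)\<^sup>2)"
  by (simp add: norm_vec_def L2_set_def sum_nonneg)

definition tstein_op :: "real ^ 'n ^ 'n \<Rightarrow> real ^ 'n ^ 'n \<Rightarrow> real ^ 'n ^ 'n \<Rightarrow> real ^ 'n ^ 'n"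
  where "tstein_op A B Z = Z - A ** transpose Z ** B"

lemma linear_tstein_op: "linear (tstein_op A B)"
proof (rule linearI)
  show "tstein_op A B (Y + Z) = tstein_op A B Y + tstein_op A B Z" for Y Z
    by (simp add: tstein_op_def transpose_def matrix_matrix_mult_def vec_eq_iff
        algebra_simps sum.distrib sum_distrib_left sum_distrib_right)
  show "tstein_op A B (r *\<^sub>R Z) = r *\<^sub>R tstein_op A B Z" for r Z
    by (simp add: tstein_op_def transpose_def matrix_matrix_mult_def vec_eq_iff
        algebra_simps sum_distrib_left sum_distrib_right)
qed

text \<open>The number written as the norm of \<open>\<delta>S\<close>; it is not the norm of an actual operator.\<close>

definition delta_S_bound ::
    "real ^ 'n ^ 'n \<Rightarrow> real ^ 'n ^ 'n \<Rightarrow> real ^ 'n ^ 'n \<Rightarrow> real ^ 'n ^ 'n \<Rightarrow> real"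
  where "delta_S_bound A B dA dB = norm A * norm dB + norm dA * (norm B + norm dB)"

text \<open>Only meaningful for a bijective \<open>T\<close>, since \<^const>\<open>inv\<close> is a choice function otherwise.\<close>

definition cond_number :: "('a::real_normed_vector \<Rightarrow> 'a) \<Rightarrow> real"
  where "cond_number T = onorm T * onorm (inv T)"

end

theory Submission
  imports Defs
begin

text \<open>
  Subtracting the unperturbed equation \<open>S X = C\<close> from the perturbed one gives
  \<open>S \<delta>X = \<delta>C + R\<close>, where the residual
  \<open>R = A (X + \<delta>X)\<^sup>T \<delta>B + \<delta>A (X + \<delta>X)\<^sup>T (B + \<delta>B)\<close> collects the effect of perturbing the
  coefficients. Because the Frobenius norm is submultiplicative
  (\<open>norm_matrix_matrix_mult_le\<close>) and invariant under transposition (\<open>norm_transpose\<close>), the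
  number written as the norm of \<open>\<delta>S\<close> is exactly what makes \<open>R\<close> at most that number times
  \<open>norm (X + \<delta>X)\<close>.

  What remains is the standard perturbation argument for an invertible linear equation
  \<open>T x = c\<close> (\<open>relative_perturbation_bound\<close>): applying \<open>T\<^sup>-\<^sup>1\<close> bounds \<open>\<delta>x\<close> by an expression
  that contains \<open>\<delta>x\<close> again, with factor less than one, and so can be solved for \<open>\<delta>x\<close>; the
  bound \<open>norm c \<le> onorm T * norm x\<close> then converts the absolute error into a relative one.
\<close>

lemma norm_transpose:
  fixes M :: "real ^ 'n ^ 'm"
  shows "norm (transpose M) = norm M"
proof -
  have "(\<Sum>i\<in>UNIV. \<Sum>j\<in>UNIV. (transpose M $ i $ j)\<^sup>2) = (\<Sum>i\<in>UNIV. \<Sum>j\<in>UNIV. (M $ i $ j)\<^sup>2)"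
    unfolding transpose_def by (subst sum.swap) simp
  then show ?thesis
    by (simp only: norm_matrix_eq_frobenius)
qed

text \<open>Each entry of \<open>M ** N\<close> is the inner product of a row of \<open>M\<close> with a column of \<open>N\<close>, so
  Cauchy--Schwarz bounds its square by a product whose sum over all entries factorizes.\<close>

lemma norm_matrix_matrix_mult_le:
  fixes M :: "real ^ 'k ^ 'm" and N :: "real ^ 'n ^ 'k"
  shows "norm (M ** N) \<le> norm M * norm N"
proof (rule power2_le_imp_le)
  have norm_sq: "(norm P)\<^sup>2 = (\<Sum>i\<in>UNIV. (norm (P $ i))\<^sup>2)" for P :: "real ^ 'a ^ 'b"
    by (simp add: norm_vec_def L2_set_def sum_nonneg)
  have "(norm (M ** N))\<^sup>2 = (\<Sum>i\<in>UNIV. \<Sum>j\<in>UNIV. ((M ** N) $ i $ j)\<^sup>2)"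
    by (simp add: norm_matrix_eq_frobenius sum_nonneg)
  also have "\<dots> = (\<Sum>i\<in>UNIV. \<Sum>j\<in>UNIV. (M $ i \<bullet> transpose N $ j)\<^sup>2)"
    by (simp add: matrix_matrix_mult_def transpose_def inner_vec_def)
  also have "\<dots> \<le> (\<Sum>i\<in>UNIV. \<Sum>j\<in>UNIV. (norm (M $ i))\<^sup>2 * (norm (transpose N $ j))\<^sup>2)"
    by (intro sum_mono) (simp add: Cauchy_Schwarz_ineq power2_norm_eq_inner)
  also have "\<dots> = (norm M)\<^sup>2 * (norm (transpose N))\<^sup>2"
    by (simp add: norm_sq sum_product)
  finally show "(norm (M ** N))\<^sup>2 \<le> (norm M * norm N)\<^sup>2"
    by (simp add: norm_transpose power_mult_distrib)
qed simp

lemma matrix_add_rdistrib: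
  fixes M N :: "'a::semiring_1 ^ 'k ^ 'm"
  shows "(M + N) ** P = M ** P + N ** P"
  by (simp add: matrix_matrix_mult_def vec_eq_iff distrib_right sum.distrib)

text \<open>The perturbation of the operator enters only through a residual \<open>r\<close> whose size is
  controlled by the perturbed solution \<open>x + dx\<close>, so \<open>d\<close> need not be the norm of a linear
  operator. Finite dimension serves to make \<open>T\<close> and its inverse bounded.\<close>

lemma relative_perturbation_bound:
  fixes T :: "'a::euclidean_space \<Rightarrow> 'a"
  assumes "linear T" and "bij T"
    and Tx: "T x = c" and "c \<noteq> 0"
    and Tdx: "T dx = dc + r" and r: "norm r \<le> d * norm (x + dx)" and "0 \<le> d"
    and small: "onorm (inv T) * d < 1"
  shows "norm dx / norm x \<le>
    cond_number T / (1 - cond_number T * d / onorm T) * (norm dc / norm c + d / onorm T)"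
proof -
  define s where "s = onorm (inv T)"
  have T: "bounded_linear T"
    using \<open>linear T\<close> by (simp add: linear_conv_bounded_linear)
  have "linear (inv T)"
    using \<open>linear T\<close> \<open>bij T\<close> by (meson bij_is_inj inj_linear_imp_inv_linear)
  then have inv_T: "bounded_linear (inv T)"
    by (simp add: linear_conv_bounded_linear)
  have "0 \<le> s"
    unfolding s_def by (rule onorm_pos_le[OF inv_T])
  have c_le: "norm c \<le> onorm T * norm x"
    using onorm[OF T, of x] Tx by simp
  have "x \<noteq> 0"
    using Tx \<open>c \<noteq> 0\<close> linear_0[OF \<open>linear T\<close>] by auto
  have "onorm T > 0"
    using c_le \<open>c \<noteq> 0\<close> onorm_pos_le[OF T] by (cases "onorm T = 0") auto
  have "dx = inv T (dc + r)"
    using Tdx \<open>bij T\<close> by (metis bij_is_inj inv_f_f)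
  then have "norm dx \<le> s * norm (dc + r)"
    unfolding s_def using onorm[OF inv_T] by simp
  also have "\<dots> \<le> s * (norm dc + d * (norm x + norm dx))"
  proof (rule mult_left_mono[OF _ \<open>0 \<le> s\<close>])
    have "d * norm (x + dx) \<le> d * (norm x + norm dx)"
      using \<open>0 \<le> d\<close> by (simp add: mult_left_mono norm_triangle_ineq)
    then show "norm (dc + r) \<le> norm dc + d * (norm x + norm dx)"
      using norm_triangle_ineq[of dc r] r by linarith
  qed
  finally have "(1 - s * d) * norm dx \<le> s * (norm dc + d * norm x)"
    by (simp add: algebra_simps)
  then have "norm dx \<le> s / (1 - s * d) * (norm dc + d * norm x)"
    using small by (simp add: s_def field_simps)
  then have "norm dx / norm x \<le> s / (1 - s * d) * (norm dc + d * norm x) / norm x"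
    by (rule divide_right_mono) simp
  also have "\<dots> = s / (1 - s * d) * (norm dc / norm x + d)"
    using \<open>x \<noteq> 0\<close> by (simp add: add_divide_distrib distrib_left)
  also have "\<dots> \<le> s / (1 - s * d) * (norm dc * onorm T / norm c + d)"
  proof (rule mult_left_mono)
    have "1 / norm x \<le> onorm T / norm c"
      using c_le \<open>x \<noteq> 0\<close> \<open>c \<noteq> 0\<close> by (simp add: field_simps)
    then have "norm dc * (1 / norm x) \<le> norm dc * (onorm T / norm c)"
      by (rule mult_left_mono) simp
    then show "norm dc / norm x + d \<le> norm dc * onorm T / norm c + d"
      by simp
    show "0 \<le> s / (1 - s * d)"
      using \<open>0 \<le> s\<close> small by (simp add: s_def)
  qed
  also have "\<dots> = cond_number T / (1 - cond_number T * d / onorm T)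
      * (norm dc / norm c + d / onorm T)"
  proof -
    have "norm dc * onorm T / norm c + d = onorm T * (norm dc / norm c + d / onorm T)"
      using \<open>onorm T > 0\<close> by (simp add: distrib_left)
    moreover have "cond_number T * d / onorm T = s * d"
      using \<open>onorm T > 0\<close> by (simp add: cond_number_def s_def)
    moreover have "cond_number T = s * onorm T"
      by (simp add: cond_number_def s_def)
    ultimately show ?thesis
      by simp
  qed
  finally show ?thesis .
qed

theorem mainTheorem4:
  fixes A B C X dA dB dC dX :: "real ^ 'n ^ 'n"
    and S :: "real ^ 'n ^ 'n \<Rightarrow> real ^ 'n ^ 'n"
    and normdS :: real
  defines "S \<equiv> tstein_op A B"
    and "normdS \<equiv> delta_S_bound A B dA dB"
  assumes "C \<noteq> 0"
    and "bij S"
    and "X = A ** transpose X ** B + C"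
    and "X + dX = (A + dA) ** transpose (X + dX) ** (B + dB) + (C + dC)"
    and "onorm (inv S) * normdS < 1"
  shows "norm dX / norm X \<le>
    cond_number S / (1 - cond_number S * normdS / onorm S) *
      (norm dC / norm C + normdS / onorm S)"
proof -
  define Y where "Y = X + dX"
  define R where "R = A ** transpose Y ** dB + dA ** transpose Y ** (B + dB)"
  have "linear S"
    unfolding S_def by (rule linear_tstein_op)
  have SX: "S X = C"
    using assms(5) by (simp add: S_def tstein_op_def algebra_simps)
  have "S Y = C + dC + R"
  proof -
    have "Y = (A + dA) ** transpose Y ** (B + dB) + (C + dC)"
      using assms(6) by (simp only: Y_def)
    moreover have "(A + dA) ** transpose Y ** (B + dB) = A ** transpose Y ** B + R"
      by (simp add: R_def matrix_add_ldistrib matrix_add_rdistrib)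
    ultimately show ?thesis
      by (simp add: S_def tstein_op_def algebra_simps)
  qed
  then have SdX: "S dX = dC + R"
    using SX linear_add[OF \<open>linear S\<close>, of X dX] by (simp add: Y_def)
  have product: "norm (P ** transpose Y ** Q) \<le> norm P * norm Q * norm Y"
    for P Q :: "real ^ 'n ^ 'n"
  proof -
    have "norm (P ** transpose Y ** Q) \<le> norm (P ** transpose Y) * norm Q"
      by (rule norm_matrix_matrix_mult_le)
    also have "\<dots> \<le> norm P * norm Y * norm Q"
      using norm_matrix_matrix_mult_le[of P "transpose Y"]
      by (simp add: mult_right_mono norm_transpose)
    finally show ?thesis
      by (simp add: ac_simps)
  qed
  have "norm R \<le> norm A * norm dB * norm Y + norm dA * norm (B + dB) * norm Y"
    unfolding R_def by (intro norm_triangle_le add_mono product)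
  also have "\<dots> \<le> norm A * norm dB * norm Y + norm dA * (norm B + norm dB) * norm Y"
    by (intro add_left_mono mult_right_mono mult_left_mono norm_triangle_ineq norm_ge_zero)
  also have "\<dots> = normdS * norm Y"
    by (simp add: normdS_def delta_S_bound_def distrib_right)
  finally have R: "norm R \<le> normdS * norm (X + dX)"
    by (simp only: Y_def)
  have "0 \<le> normdS"
    by (simp add: normdS_def delta_S_bound_def)
  with \<open>linear S\<close> \<open>bij S\<close> SX \<open>C \<noteq> 0\<close> SdX R show ?thesis
    using assms(7) by (rule relative_perturbation_bound)
qed

end
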